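(* Let $\mathcal{X}$, $\mathcal{D}$, $\mathcal{D}_I$, $\mathcal{X}_I$, $\bot$, $C$, $\mathscr{F}$ and $d_K$ be as defined in the context. Let $X_1, X_2, \ldots$ be i.i.d. random variables with distribution $\mathcal{D}$, the training set of size $n$ being a realization of $X_1,\ldots,X_n$. Let $\delta \geq 0$. Assume that (1) $\mathscr{F} \neq \emptyset$; and (2) there is a map $F \in \mathscr{F}$ such that the i.i.d. random variables $F(X_1), F(X_2), \ldots$, whose common distribution on $\mathcal{X}_I \cup \{\bot\}$ is denoted $\mathcal{D}'$, satisfy $d_K(\mathcal{D}', \mathcal{D}_I) \leq \delta$. Then there exists an estimator $\hat{\mathcal{D}}_I \equiv \hat{\mathcal{D}}_I(n)$ of $\mathcal{D}_I$, depending on the size $n$ of the training set, such that almost surely $$\lim_{n \to \infty} d_K\big(\hat{\mathcal{D}}_I(n), \mathcal{D}_I\big) \leq \delta .$$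
   Context: **Spaces and distributions.** $\mathcal{X}$ is an at most countable subset of $\mathbb{R}^{h \times w \times 3}$ (the space of images), with a $\sigma$-algebra $\mathcal{A}_\mathcal{X}$ containing all singletons (hence all subsets of $\mathcal{X}$). For a probability measure $P$ on $\mathcal{X}$ and $x \in \mathcal{X}$, write $P(x) := P(\{x\})$, and $\mathrm{supp}(P) = \{x \in \mathcal{X} : P(x) > 0\}$. $\mathcal{D}$ (the training distribution) and $\mathcal{D}_I$ (the intended distribution) are probability measures on $(\mathcal{X}, \mathcal{A}_\mathcal{X})$ with $\mathrm{supp}(\mathcal{D}) \subsetneq \mathrm{supp}(\mathcal{D}_I) \subset \mathcal{X}$ and $\mathrm{supp}(\mathcal{D}) \subsetneq \mathcal{X}$. **Intended set.** For a fixed $\epsilon > 0$, $\mathcal{X}_I := \{x \in \mathcal{X} : \mathcal{D}_I(x) > \epsilon\} \subset \mathrm{supp}(\mathcal{D}_I)$. The symbol $\bot$ denotes a distinguished element of $\mathcal{X}$, the "empty image". For simplicity it is assumed that $\mathrm{supp}(\mathcal{D}_I) = \mathcal{X}_I \cup \{\bot\}$. **Oracle classifier and relevant-part maps.** $\mathcal{Y}$ is an at most countable set of labels and $C : \mathcal{X} \to \mathcal{Y}$ is a fixed map (the oracle classifier giving ground-truth labels). $\mathscr{F}$ is the set of all maps $F : \mathcal{X} \to \mathcal{X}_I \cup \{\bot\}$ such that $C(F(x)) = C(x)$ for all $x \in \mathcal{X}$. **Distance.** For probability measures $P, Q$ on $\mathcal{X}$ (measures on $\mathcal{X}_I \cup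 \{\bot\}$ being regarded as measures on $\mathcal{X}$), $d_K(P, Q) := \sup_{x \in \mathcal{X}_I} |P(x) - Q(x)|$. **Estimator.** As usual in statistics, an estimator $\hat{\mathcal{D}}_I(n)$ of $\mathcal{D}_I$ is a random probability measure on $\mathcal{X}_I \cup \{\bot\}$ obtained by applying to the sample a rule that does not depend on the unknown distributions $\mathcal{D}, \mathcal{D}_I$; here, for each $n$, a rule sending $(F(X_1), \ldots, F(X_n))$ to a probability measure on $\mathcal{X}_I \cup \{\bot\}$, where $F$ is the map in assumption (2). *)

theory Defs
  imports "HOL-Probability.Probability"
begin

type_synonym ('h, 'w) image = "real ^ 3 ^ 'w ^ 'h"

text \<open>
  A measurable space is passed as a term of type \<^typ>\<open>'a measure\<close> of which only
  \<^const>\<open>space\<close> and \<^const>\<open>sets\<close> matter; \<open>space (prob_algebra \<X>)\<close> is then the set of all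
  probability measures on \<open>\<X>\<close>.
\<close>

definition atom_supp :: "'a measure \<Rightarrow> 'a set" where
  "atom_supp P = {x \<in> space P. measure P {x} > 0}"

definition intended_set :: "real \<Rightarrow> 'a measure \<Rightarrow> 'a set" where
  "intended_set \<epsilon> \<D>\<^sub>I = {x \<in> space \<D>\<^sub>I. measure \<D>\<^sub>I {x} > \<epsilon>}"

definition training_model ::
    "'a measure \<Rightarrow> 'a \<Rightarrow> real \<Rightarrow> 'a measure \<Rightarrow> 'a measure \<Rightarrow> bool" where
  "training_model \<X> b \<epsilon> \<D> \<D>\<^sub>I \<longleftrightarrow>
     \<D> \<in> space (prob_algebra \<X>) \<and> \<D>\<^sub>I \<in> space (prob_algebra \<X>) \<and>
     atom_supp \<D> \<subset> atom_supp \<D>\<^sub>I \<and> atom_supp \<D>\<^sub>I \<subseteq> space \<X> \<and> atom_supp \<D> \<subset> space \<X> \<and>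
     atom_supp \<D>\<^sub>I = intended_set \<epsilon> \<D>\<^sub>I \<union> {b}"

definition relevant_part_maps :: "'a measure \<Rightarrow> ('a \<Rightarrow> 'y) \<Rightarrow> 'a set \<Rightarrow> ('a \<Rightarrow> 'a) set" where
  "relevant_part_maps \<X> C S = {F \<in> space \<X> \<rightarrow> S. \<forall>x\<in>space \<X>. C (F x) = C x}"

text \<open>
  The supremum is over the intended set \<open>A\<close>, which is nonempty in every \<^const>\<open>training_model\<close>
  over a countable space with measurable points: otherwise \<open>\<D>\<^sub>I\<close> would be concentrated on \<open>b\<close>
  and \<open>\<D>\<close> would have no atoms. Only point masses in \<open>A\<close> enter, so it is immaterial whether \<open>P\<close>
  lives on \<open>\<X>\<close> or on a subset containing \<open>A\<close>.
\<close>

definition d_K :: "'a set \<Rightarrow> 'a measure \<Rightarrow> 'a measure \<Rightarrow> real" where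
  "d_K A P Q = (SUP x\<in>A. \<bar>measure P {x} - measure Q {x}\<bar>)"

definition iid_with :: "'o measure \<Rightarrow> (nat \<Rightarrow> 'o \<Rightarrow> 'a) \<Rightarrow> 'a measure \<Rightarrow> bool" where
  "iid_with M X P \<longleftrightarrow>
     prob_space M \<and> prob_space.indep_vars M (\<lambda>_. P) X UNIV \<and> (\<forall>i. distr M P (X i) = P)"

text \<open>
  \<open>E n\<close> maps samples of size \<open>n\<close> with values in \<open>S\<close> to probability measures on \<open>S\<close>, regarded as
  measures on \<open>\<X>\<close> concentrated on \<open>S\<close>. For countable \<open>S\<close> the product sigma-algebra on samples
  is discrete, so \<open>E n\<close> applied to a random sample is a random probability measure.
\<close>

definition estimation_rule ::
    "'a measure \<Rightarrow> 'a set \<Rightarrow> (nat \<Rightarrow> 'a list \<Rightarrow> 'a measure) \<Rightarrow> bool" where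
  "estimation_rule \<X> S E \<longleftrightarrow>
     (\<forall>n. E n \<in> count_space {xs. length xs = n \<and> set xs \<subseteq> S} \<rightarrow>\<^sub>M prob_algebra \<X> \<and>
          (\<forall>xs. length xs = n \<and> set xs \<subseteq> S \<longrightarrow> measure (E n xs) S = 1))"

end

theory Submission
  imports Defs
begin

text \<open>
  The estimator is the empirical measure of \<open>F X\<^sub>1, \<dots>, F X\<^sub>n\<close>. Every point of the intended set
  carries mass greater than \<open>\<epsilon>\<close>, so that set is finite, and on it the empirical frequencies converge
  uniformly almost surely to \<open>\<D>'\<close>; hence \<^const>\<open>d_K\<close> converges to the distance between \<open>\<D>'\<close> and
  \<open>\<D>\<^sub>I\<close>. The law of large numbers for indicators follows from Hoeffding's inequality and the
  Borel-Cantelli lemma.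
\<close>

text \<open>For a fixed tolerance \<open>e\<close>, Hoeffding's inequality makes the probability of
  a deviation of at least \<open>e\<close> decay geometrically in \<open>n\<close>, so by
  Borel-Cantelli almost surely only finitely many such deviations occur. The bound on
  \<open>Z 0\<close> passes to every \<open>Z i\<close> because the laws agree.\<close>

lemma (in prob_space) strong_law_interval_bounded:
  fixes Z :: "nat \<Rightarrow> 'a \<Rightarrow> real"
  assumes indep: "indep_vars (\<lambda>_. borel) Z UNIV"
    and distr: "\<And>i. distr M borel (Z i) = distr M borel (Z 0)"
    and bdd: "AE \<omega> in M. Z 0 \<omega> \<in> {a..b}" and "a < b"
  shows "AE \<omega> in M. (\<lambda>n. (\<Sum>i<n. Z i \<omega>) / n) \<longlonglongrightarrow> expectation (Z 0)"
proof -
  let ?\<mu> = "expectation (Z 0)"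
  have rv [measurable]: "random_variable borel (Z i)" for i
    using indep unfolding indep_vars_def by blast
  have "AE \<omega> in M. \<forall>\<^sub>F n in sequentially. \<bar>(\<Sum>i<n. Z i \<omega>) / n - ?\<mu>\<bar> < e" if "e > 0" for e
  proof -
    define B where "B n = {\<omega> \<in> space M. \<bar>(\<Sum>i<n. Z i \<omega>) / n - ?\<mu>\<bar> \<ge> e}" for n :: nat
    \<comment> \<open>The Hoeffding bound is \<open>2 * q ^ n\<close>: each further observation
      contributes one factor \<open>q\<close>.\<close>
    define q where "q = exp (- 2 * e\<^sup>2 / (b - a)\<^sup>2)"
    have [measurable]: "B n \<in> sets M" for n
      unfolding B_def by measurable
    have B_le: "prob (B n) \<le> 2 * q ^ n" if "n > 0" for n
    proof -
      interpret Hoeffding_ineq_iid M "{..<n}" Z "Z 0" a b ?\<mu>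
        using indep_vars_subset[OF indep, of "{..<n}"] distr bdd
        by unfold_locales auto
      have "{..<n} \<noteq> {}"
        using that by auto
      from Hoeffding_ineq_abs_ge'[OF less_imp_le[OF \<open>e > 0\<close>] \<open>a < b\<close> this]
      have "prob (B n) \<le> 2 * exp (- 2 * n * e\<^sup>2 / (b - a)\<^sup>2)"
        by (simp add: B_def)
      also have "exp (- 2 * n * e\<^sup>2 / (b - a)\<^sup>2) = q ^ n"
        unfolding q_def exp_of_nat_mult[symmetric] by (simp add: mult_ac)
      finally show ?thesis .
    qed
    have "q < 1" "q \<ge> 0"
      using \<open>e > 0\<close> \<open>a < b\<close> by (auto simp: q_def)
    then have "summable (\<lambda>n. 2 * q ^ n)"
      by (intro summable_mult summable_geometric) auto
    \<comment> \<open>The Hoeffding bound is available for a nonempty index set, so the comparison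
      starts at \<open>n = 1\<close>.\<close>
    then have "summable (\<lambda>n. prob (B n))"
      by (rule summable_comparison_test_ev[rotated])
         (use B_le in \<open>auto simp: eventually_sequentially intro!: exI[of _ 1]\<close>)
    then have "AE \<omega> in M. \<forall>\<^sub>F n in sequentially. \<omega> \<in> space M - B n"
      by (intro borel_cantelli_AE1) (auto simp: less_top[symmetric])
    then show ?thesis
      by eventually_elim (auto simp: B_def not_le elim!: eventually_mono)
  qed
  \<comment> \<open>The exceptional null set depends on \<open>e\<close>; the tolerances
    \<open>1 / (k + 1)\<close> suffice for convergence and leave only a countable union of null
    sets.\<close>
  then have "AE \<omega> in M. \<forall>k::nat. \<forall>\<^sub>F n in sequentially. \<bar>(\<Sum>i<n. Z i \<omega>) / n - ?\<mu>\<bar> < inverse (Suc k)"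
    unfolding AE_all_countable by simp
  then show ?thesis
  proof eventually_elim
    case (elim \<omega>)
    show ?case
    proof (rule tendstoI)
      fix e :: real assume "e > 0"
      then obtain k where "inverse (real (Suc k)) < e"
        using reals_Archimedean by blast
      then show "\<forall>\<^sub>F n in sequentially. dist ((\<Sum>i<n. Z i \<omega>) / n) ?\<mu> < e"
        using elim[rule_format, of k] by (auto simp: dist_real_def elim!: eventually_mono)
    qed
  qed
qed

text \<open>A supremum over a finite nonempty set is an iterated binary maximum, and
  \<open>max\<close> is continuous; for empty \<open>A\<close> both sides are the same constant.
  This turns pointwise convergence of masses into convergence of \<open>d_K\<close>.\<close>

lemma tendsto_SUP_finite:
  fixes f :: "'i \<Rightarrow> 'b \<Rightarrow> real"
  assumes "finite A" "\<And>x. x \<in> A \<Longrightarrow> ((\<lambda>n. f n x) \<longlongrightarrow> g x) F"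
  shows "((\<lambda>n. SUP x\<in>A. f n x) \<longlongrightarrow> (SUP x\<in>A. g x)) F"
proof (cases "A = {}")
  case False
  with assms(1) show ?thesis
    using assms(2)
  proof (induction rule: finite_ne_induct)
    case (insert x A)
    then show ?case
      by (simp add: cSup_insert sup_max tendsto_max bdd_above_finite)
  qed simp
qed simp

text \<open>Any \<open>n\<close> distinct points of mass above \<epsilon> have total mass at least
  \<open>n * \<epsilon>\<close>, which exceeds 1 once \<open>n\<close> is large.\<close>

lemma (in prob_space) finite_large_atoms:
  assumes "\<epsilon> > 0" and sets: "\<And>x. x \<in> space M \<Longrightarrow> {x} \<in> sets M"
  shows "finite {x \<in> space M. measure M {x} > \<epsilon>}"
proof (rule ccontr)
  assume "infinite {x \<in> space M. measure M {x} > \<epsilon>}"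
  obtain n :: nat where n: "1 < n * \<epsilon>"
    using reals_Archimedean3[OF \<open>\<epsilon> > 0\<close>] by blast
  obtain T where T: "T \<subseteq> {x \<in> space M. measure M {x} > \<epsilon>}" "finite T" "card T = n"
    using infinite_arbitrarily_large \<open>infinite _\<close> by meson
  have "n * \<epsilon> = (\<Sum>x\<in>T. \<epsilon>)"
    using T by simp
  also have "\<dots> \<le> (\<Sum>x\<in>T. measure M {x})"
    using T by (intro sum_mono) auto
  also have "\<dots> = measure M T"
    using T sets by (intro measure_eq_sum_singleton[symmetric]) auto
  also have "\<dots> \<le> 1"
    by simp
  finally show False
    using n by simp
qed

text \<open>An empty sample has no empirical measure; the point mass at \<open>b\<close> stands in for it.\<close>

definition empirical_measure :: "'a measure \<Rightarrow> 'a \<Rightarrow> 'a list \<Rightarrow> 'a measure" where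
  "empirical_measure \<X> b xs =
     (if xs = [] then return \<X> b else distr (uniform_count_measure {..<length xs}) \<X> ((!) xs))"

lemma nth_measurable_uniform_count_measure:
  assumes "set xs \<subseteq> space \<X>"
  shows "(!) xs \<in> uniform_count_measure {..<length xs} \<rightarrow>\<^sub>M \<X>"
proof -
  have "(!) xs \<in> {..<length xs} \<rightarrow> space \<X>"
    using assms nth_mem by blast
  then show ?thesis
    by (auto simp: measurable_def space_uniform_count_measure sets_uniform_count_measure)
qed

lemma empirical_measure_in_prob_algebra:
  assumes "b \<in> space \<X>" "set xs \<subseteq> space \<X>"
  shows "empirical_measure \<X> b xs \<in> space (prob_algebra \<X>)"
proof (cases "xs = []")
  case True
  then show ?thesis
    using assms by (simp add: empirical_measure_def space_prob_algebra prob_space_return)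
next
  case False
  then have "prob_space (uniform_count_measure {..<length xs})"
    by (intro prob_space_uniform_count_measure) auto
  from prob_space.prob_space_distr[OF this nth_measurable_uniform_count_measure[OF assms(2)]]
  show ?thesis
    using False by (simp add: empirical_measure_def space_prob_algebra)
qed

text \<open>The average of indicators is the form to which the law of large numbers applies.\<close>

lemma measure_empirical_measure:
  assumes "xs \<noteq> []" "set xs \<subseteq> space \<X>" "A \<in> sets \<X>"
  shows "measure (empirical_measure \<X> b xs) A = (\<Sum>i<length xs. indicator A (xs ! i)) / length xs"
proof -
  have "measure (empirical_measure \<X> b xs) A = card ((!) xs -` A \<inter> {..<length xs}) / length xs"
    using assms(1,3) nth_measurable_uniform_count_measure[OF assms(2)]
    by (simp add: empirical_measure_def measure_distr space_uniform_count_measure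
        measure_uniform_count_measure)
  also have "real (card ((!) xs -` A \<inter> {..<length xs})) = (\<Sum>i<length xs. indicator A (xs ! i))"
    using sum_of_bool_eq[of "{..<length xs}" "\<lambda>i. xs ! i \<in> A", where 'a = real]
    by (simp add: indicator_def of_bool_def vimage_def Int_commute)
  finally show ?thesis .
qed

text \<open>For the empty sample the claim rests on \<open>b \<in> S\<close>; for any other sample
  every indicator in the average equals 1.\<close>

lemma measure_empirical_measure_eq_1:
  assumes "b \<in> S" "set xs \<subseteq> S" "S \<in> sets \<X>"
  shows "measure (empirical_measure \<X> b xs) S = 1"
proof (cases "xs = []")
  case True
  then show ?thesis
    using assms by (simp add: empirical_measure_def measure_return)
next
  case False
  have "(\<Sum>i<length xs. indicator S (xs ! i) :: real) = (\<Sum>i<length xs. 1)"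
    using assms(2) by (intro sum.cong) (auto simp: indicator_def subset_iff)
  then show ?thesis
    using False assms sets.sets_into_space[OF assms(3)] by (subst measure_empirical_measure) auto
qed

text \<open>Samples carry the discrete sigma-algebra, so measurability of the rule reduces to its
  values being probability measures.\<close>

lemma estimation_rule_empirical_measure:
  assumes "b \<in> S" "S \<in> sets \<X>"
  shows "estimation_rule \<X> S (\<lambda>_. empirical_measure \<X> b)"
  using assms sets.sets_into_space[OF assms(2)]
  by (auto simp: estimation_rule_def intro!: empirical_measure_in_prob_algebra
      measure_empirical_measure_eq_1)

text \<open>The indicators of the events \<open>W i \<omega> \<in> A\<close> are again i.i.d., take
  values in \<open>{0..1}\<close>, and have the mass of \<open>A\<close> under the common law as
  their mean.\<close>

lemma (in prob_space) empirical_measure_tendsto: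
  fixes W :: "nat \<Rightarrow> 'a \<Rightarrow> 'b"
  assumes indep: "indep_vars (\<lambda>_. \<X>) W UNIV"
    and distr: "\<And>i. distr M \<X> (W i) = distr M \<X> (W 0)" and A: "A \<in> sets \<X>"
  shows "AE \<omega> in M. (\<lambda>n. measure (empirical_measure \<X> b (map (\<lambda>i. W i \<omega>) [0..<n])) A)
           \<longlonglongrightarrow> measure (distr M \<X> (W 0)) A"
proof -
  define Z where "Z i \<omega> = (indicator A (W i \<omega>) :: real)" for i \<omega>
  have rv [measurable]: "random_variable \<X> (W i)" for i
    using indep unfolding indep_vars_def by blast
  have indep_Z: "indep_vars (\<lambda>_. borel) Z UNIV"
    unfolding Z_def by (rule indep_vars_compose2[OF indep]) (use A in measurable)
  have "distr M borel (Z i) = distr (distr M \<X> (W i)) borel (indicator A)" for i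
    unfolding Z_def using A by (subst distr_distr) (auto simp: comp_def)
  then have distr_Z: "distr M borel (Z i) = distr M borel (Z 0)" for i
    using distr by metis
  have "expectation (Z 0) = integral\<^sup>L (distr M \<X> (W 0)) (indicator A)"
    unfolding Z_def using A by (subst integral_distr) auto
  also have "\<dots> = measure (distr M \<X> (W 0)) A"
    using sets.sets_into_space[OF A] by (simp add: Int_absorb2)
  finally have exp_Z: "expectation (Z 0) = measure (distr M \<X> (W 0)) A" .
  have "AE \<omega> in M. (\<lambda>n. (\<Sum>i<n. Z i \<omega>) / n) \<longlonglongrightarrow> expectation (Z 0)"
    by (rule strong_law_interval_bounded[OF indep_Z distr_Z, where a = 0 and b = 1])
       (auto simp: Z_def)
  \<comment> \<open>The sample values are known to lie in \<open>space \<X>\<close> only for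
    \<open>\<omega> \<in> space M\<close>. The frequency formula then holds for
    \<open>n > 0\<close>; the default value at \<open>n = 0\<close> does not affect the
    limit.\<close>
  with AE_space show ?thesis
  proof eventually_elim
    case (elim \<omega>)
    have "measure (empirical_measure \<X> b (map (\<lambda>i. W i \<omega>) [0..<n])) A = (\<Sum>i<n. Z i \<omega>) / n"
      if "n > 0" for n
      using that A measurable_space[OF rv elim(1)]
      by (subst measure_empirical_measure) (auto simp: Z_def)
    then show ?case
      using elim(2) exp_Z
      by (auto elim!: Lim_transform_eventually
          intro!: eventually_mono[OF eventually_gt_at_top[of "0::nat"]])
  qed
qed

theorem theorem1:
  fixes \<X> :: "('h::finite, 'w::finite) image measure"
    and b :: "('h, 'w) image"
    and \<Y> :: "'y set"
    and C :: "('h, 'w) image \<Rightarrow> 'y"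
    and \<epsilon> \<delta> :: real
  assumes "countable (space \<X>)"
    and "\<And>x. x \<in> space \<X> \<Longrightarrow> {x} \<in> sets \<X>"
    and "b \<in> space \<X>"
    and "countable \<Y>" and "C \<in> space \<X> \<rightarrow> \<Y>"
    and "\<epsilon> > 0" and "\<delta> \<ge> 0"
  shows "\<exists>E :: nat \<Rightarrow> ('h, 'w) image list \<Rightarrow> ('h, 'w) image measure.
    \<forall>\<D> \<D>\<^sub>I. training_model \<X> b \<epsilon> \<D> \<D>\<^sub>I \<longrightarrow>
      estimation_rule \<X> (intended_set \<epsilon> \<D>\<^sub>I \<union> {b}) E \<and>
      (\<forall>(M :: 'o measure) X F \<D>'.
         iid_with M X \<D> \<longrightarrow>
         relevant_part_maps \<X> C (intended_set \<epsilon> \<D>\<^sub>I \<union> {b}) \<noteq> {} \<longrightarrow>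
         F \<in> relevant_part_maps \<X> C (intended_set \<epsilon> \<D>\<^sub>I \<union> {b}) \<longrightarrow>
         (\<forall>i. distr M (count_space (intended_set \<epsilon> \<D>\<^sub>I \<union> {b})) (\<lambda>\<omega>. F (X i \<omega>)) = \<D>') \<longrightarrow>
         d_K (intended_set \<epsilon> \<D>\<^sub>I) \<D>' \<D>\<^sub>I \<le> \<delta> \<longrightarrow>
         (AE \<omega> in M. \<exists>L \<le> \<delta>.
            (\<lambda>n. d_K (intended_set \<epsilon> \<D>\<^sub>I) (E n (map (\<lambda>i. F (X i \<omega>)) [0..<n])) \<D>\<^sub>I)
              \<longlonglongrightarrow> L))"
proof (intro exI[of _ "\<lambda>_. empirical_measure \<X> b"] allI impI)
  \<comment> \<open>The witness is fixed before the two distributions and is built from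
    \<open>\<X>\<close> and \<open>b\<close> alone, as an estimator must be.\<close>
  fix \<D> \<D>\<^sub>I
  assume model: "training_model \<X> b \<epsilon> \<D> \<D>\<^sub>I"
  define A where "A = intended_set \<epsilon> \<D>\<^sub>I"
  define S where "S = A \<union> {b}"
  have sets_D: "sets \<D> = sets \<X>" "sets \<D>\<^sub>I = sets \<X>" and "prob_space \<D>\<^sub>I"
    using model by (auto simp: training_model_def space_prob_algebra)
  interpret \<D>\<^sub>I: prob_space \<D>\<^sub>I by fact
  have space_D: "space \<D> = space \<X>" "space \<D>\<^sub>I = space \<X>"
    using sets_D[THEN sets_eq_imp_space_eq] by simp_all
  \<comment> \<open>A countable space with measurable points has a discrete sigma-algebra.\<close>
  have sets_all: "B \<in> sets \<X>" if "B \<subseteq> space \<X>" for B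
    using sets.countable[of B \<X>] assms(2) countable_subset[OF that assms(1)] that by blast
  have finite_A: "finite A"
    unfolding A_def intended_set_def using assms(6)
    by (rule \<D>\<^sub>I.finite_large_atoms) (simp add: assms(2) sets_D space_D)
  have S_sub: "S \<subseteq> space \<X>"
    using assms(3) space_D by (auto simp: S_def A_def intended_set_def)
  have rule: "estimation_rule \<X> S (\<lambda>_. empirical_measure \<X> b)"
    by (rule estimation_rule_empirical_measure[OF _ sets_all[OF S_sub]]) (simp add: S_def)
  have conv: "AE \<omega> in M. \<exists>L \<le> \<delta>.
      (\<lambda>n. d_K A (empirical_measure \<X> b (map (\<lambda>i. F (X i \<omega>)) [0..<n])) \<D>\<^sub>I) \<longlonglongrightarrow> L"
    if iid: "iid_with M X \<D>" and F: "F \<in> relevant_part_maps \<X> C S"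
      and D': "\<forall>i. distr M (count_space S) (\<lambda>\<omega>. F (X i \<omega>)) = \<D>'"
      and le: "d_K A \<D>' \<D>\<^sub>I \<le> \<delta>"
    for M :: "'o measure" and X F \<D>'
  proof -
    interpret M: prob_space M
      using iid by (simp add: iid_with_def)
    have indep: "M.indep_vars (\<lambda>_. \<D>) X UNIV" and distr_X: "\<And>i. distr M \<D> (X i) = \<D>"
      using iid by (auto simp: iid_with_def)
    have X [measurable]: "X i \<in> M \<rightarrow>\<^sub>M \<D>" for i
      using indep unfolding M.indep_vars_def by blast
    have FS: "F x \<in> S" if "x \<in> space \<X>" for x
      using F that by (auto simp: relevant_part_maps_def)
    \<comment> \<open>Two targets are needed for \<open>F\<close>: \<open>\<D>'\<close> is a law on
      \<open>count_space S\<close>, while the empirical measures live on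
      \<open>\<X>\<close>.\<close>
    have F_S: "F \<in> \<D> \<rightarrow>\<^sub>M count_space S"
      using FS by (auto simp: measurable_def space_D sets_D intro: sets_all)
    have "(\<lambda>x. x) \<in> count_space S \<rightarrow>\<^sub>M \<X>"
      using S_sub by auto
    with F_S have F_X [measurable]: "F \<in> \<D> \<rightarrow>\<^sub>M \<X>"
      using measurable_compose by blast
    have indep': "M.indep_vars (\<lambda>_. \<X>) (\<lambda>i \<omega>. F (X i \<omega>)) UNIV"
      by (rule M.indep_vars_compose2[OF indep]) simp
    have "distr M \<X> (\<lambda>\<omega>. F (X i \<omega>)) = distr (distr M \<D> (X i)) \<X> F" for i
      by (simp add: distr_distr comp_def)
    then have distr': "distr M \<X> (\<lambda>\<omega>. F (X i \<omega>)) = distr M \<X> (\<lambda>\<omega>. F (X 0 \<omega>))" for i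
      by (simp add: distr_X)
    \<comment> \<open>The laws on \<open>\<X>\<close> and on \<open>count_space S\<close> are
      different measures, but both give \<open>{x}\<close> the probability that
      \<open>F (X 0 \<omega>) = x\<close>.\<close>
    have mass: "measure (distr M \<X> (\<lambda>\<omega>. F (X 0 \<omega>))) {x} = measure \<D>' {x}" if "x \<in> A" for x
    proof -
      have "x \<in> S"
        using that by (simp add: S_def)
      have "(\<lambda>\<omega>. F (X 0 \<omega>)) \<in> M \<rightarrow>\<^sub>M count_space S"
        using X F_S by (rule measurable_compose)
      then have "measure \<D>' {x} = measure M ((\<lambda>\<omega>. F (X 0 \<omega>)) -` {x} \<inter> space M)"
        using \<open>x \<in> S\<close> D'[rule_format, of 0, symmetric] by (simp add: measure_distr)
      moreover have "{x} \<in> sets \<X>"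
        using \<open>x \<in> S\<close> S_sub by (intro sets_all) auto
      ultimately show ?thesis
        by (simp add: measure_distr)
    qed
    \<comment> \<open>Finiteness of \<open>A\<close> allows one null set to serve all its
      points.\<close>
    have "AE \<omega> in M. \<forall>x\<in>A.
        (\<lambda>n. measure (empirical_measure \<X> b (map (\<lambda>i. F (X i \<omega>)) [0..<n])) {x})
          \<longlonglongrightarrow> measure \<D>' {x}"
    proof (rule AE_finite_allI[OF finite_A])
      fix x assume "x \<in> A"
      then have "{x} \<in> sets \<X>"
        using S_sub by (intro sets_all) (simp add: S_def subset_iff)
      from M.empirical_measure_tendsto[OF indep' distr' this]
      show "AE \<omega> in M. (\<lambda>n. measure (empirical_measure \<X> b (map (\<lambda>i. F (X i \<omega>)) [0..<n])) {x})
          \<longlonglongrightarrow> measure \<D>' {x}"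
        by (simp add: mass[OF \<open>x \<in> A\<close>])
    qed
    then show ?thesis
    proof eventually_elim
      case (elim \<omega>)
      \<comment> \<open>The limit \<open>L\<close> is exactly
        \<open>d_K A \<D>' \<D>\<^sub>I\<close>, which is at most \<delta> by assumption.\<close>
      then have "(\<lambda>n. d_K A (empirical_measure \<X> b (map (\<lambda>i. F (X i \<omega>)) [0..<n])) \<D>\<^sub>I)
          \<longlonglongrightarrow> d_K A \<D>' \<D>\<^sub>I"
        unfolding d_K_def by (intro tendsto_SUP_finite finite_A tendsto_intros) auto
      with le show ?case
        by blast
    qed
  qed
  show "estimation_rule \<X> (intended_set \<epsilon> \<D>\<^sub>I \<union> {b}) (\<lambda>_. empirical_measure \<X> b) \<and>
      (\<forall>(M :: 'o measure) X F \<D>'.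
         iid_with M X \<D> \<longrightarrow>
         relevant_part_maps \<X> C (intended_set \<epsilon> \<D>\<^sub>I \<union> {b}) \<noteq> {} \<longrightarrow>
         F \<in> relevant_part_maps \<X> C (intended_set \<epsilon> \<D>\<^sub>I \<union> {b}) \<longrightarrow>
         (\<forall>i. distr M (count_space (intended_set \<epsilon> \<D>\<^sub>I \<union> {b})) (\<lambda>\<omega>. F (X i \<omega>)) = \<D>') \<longrightarrow>
         d_K (intended_set \<epsilon> \<D>\<^sub>I) \<D>' \<D>\<^sub>I \<le> \<delta> \<longrightarrow>
         (AE \<omega> in M. \<exists>L \<le> \<delta>.
            (\<lambda>n. d_K (intended_set \<epsilon> \<D>\<^sub>I)
                    (empirical_measure \<X> b (map (\<lambda>i. F (X i \<omega>)) [0..<n])) \<D>\<^sub>I) \<longlonglongrightarrow> L))"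
    using rule conv unfolding S_def A_def by blast
qed

end
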